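(* Let $n\ge 1$ and let $J$ be a subset of $[n-1]$. (i) If $\sigma\in\mathfrak{S}_n$ and $\mathrm{DES}\,\sigma=J$, then $\mathrm{fix}\,\sigma\le n-|J|$. (ii) Let $F_n(J)$ be the set of all permutations $\sigma\in\mathfrak{S}_n$ such that $\mathrm{DES}\,\sigma=J$ and $\mathrm{fix}\,\sigma=n-|J|$. Let $G(J)$ be the set of all derangements $\tau$ on $J$ such that $\tau(i)>\tau(i+1)$ whenever $i$ and $i+1$ both belong to $J$. Then $$\sum_{\sigma\in F_n(J)} s^{\mathrm{exc}\,\sigma}=\sum_{\tau\in G(J)} s^{\mathrm{exc}\,\tau}.$$
   Context: $[n]=\{1,2,\dots,n\}$ (and $[0]=\emptyset$). For a finite set of integers $J=\{j_1<j_2<\cdots<j_r\}$, $\mathfrak{S}_J$ denotes the set of all permutations of $J$ (bijections $J\to J$), and $\mathfrak{S}_n=\mathfrak{S}_{[n]}$. For $\sigma\in\mathfrak{S}_J$: $\mathrm{fix}\,\sigma=|\{i:1\le i\le r,\ \sigma(j_i)=j_i\}|$ (number of fixed points); $\mathrm{exc}\,\sigma=|\{i:1\le i\le r,\ \sigma(j_i)>j_i\}|$ (number of excedances); $\mathrm{DES}\,\sigma=\{i:1\le i\le r-1,\ \sigma(j_i)>\sigma(j_{i+1})\}$ (descent set). A derangement on $J$ is an element of $\mathfrak{S}_J$ with no fixed point. If $J=\emptyset$, the empty permutation is the unique element of $\mathfrak{S}_J$, is a derangement, and has $0$ excedances. *)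

theory Defs
  imports
    "HOL-Combinatorics.Permutations"
    "HOL-Computational_Algebra.Polynomial"
begin

(* A permutation of J is a total function with "\<sigma> permutes J": a bijection of J extended by
   the identity outside J. The extension would contribute fixed points, so the statistics
   below take J as an argument and only look at the elements of J. *)

(* j_i for J = {j_1 < ... < j_r}, counted from 1; only meaningful for 1 \<le> i \<le> card J. *)
definition elem_at :: "'a::linorder set \<Rightarrow> nat \<Rightarrow> 'a" where
  "elem_at J i = sorted_list_of_set J ! (i - 1)"

definition num_fix :: "'a::linorder set \<Rightarrow> ('a \<Rightarrow> 'a) \<Rightarrow> nat" where
  "num_fix J \<sigma> = card {i. 1 \<le> i \<and> i \<le> card J \<and> \<sigma> (elem_at J i) = elem_at J i}"

definition exc :: "'a::linorder set \<Rightarrow> ('a \<Rightarrow> 'a) \<Rightarrow> nat" where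
  "exc J \<sigma> = card {i. 1 \<le> i \<and> i \<le> card J \<and> \<sigma> (elem_at J i) > elem_at J i}"

definition DES :: "'a::linorder set \<Rightarrow> ('a \<Rightarrow> 'a) \<Rightarrow> nat set" where
  "DES J \<sigma> = {i. 1 \<le> i \<and> i \<le> card J - 1 \<and> \<sigma> (elem_at J i) > \<sigma> (elem_at J (i + 1))}"

definition derangement_on :: "'a set \<Rightarrow> ('a \<Rightarrow> 'a) \<Rightarrow> bool" where
  "derangement_on J \<tau> \<longleftrightarrow> \<tau> permutes J \<and> (\<forall>j\<in>J. \<tau> j \<noteq> j)"

definition F_set :: "nat \<Rightarrow> nat set \<Rightarrow> (nat \<Rightarrow> nat) set" where
  "F_set n J = {\<sigma>. \<sigma> permutes {1..n} \<and> DES {1..n} \<sigma> = J \<and> num_fix {1..n} \<sigma> = n - card J}"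

definition G_set :: "nat set \<Rightarrow> (nat \<Rightarrow> nat) set" where
  "G_set J = {\<tau>. derangement_on J \<tau> \<and> (\<forall>i. i \<in> J \<and> i + 1 \<in> J \<longrightarrow> \<tau> i > \<tau> (i + 1))}"

end

(* By strict descent inside a block (a maximal run of positions i, ..., k with i, ..., k - 1 in
   J = DES \<sigma>) a block contains at most one fixed point, and there are n - |J| blocks.  In the
   extremal case every block contains exactly one; the excedances of the block lie before it
   and the remaining points after it.  Deleting all fixed points and closing the gaps moves a
   non-fixed position i to i if \<sigma> i > i and to i - 1 otherwise, which maps the non-fixed points
   increasingly onto J.  Conversely, in a derangement of J the place where a fixed point has to
   be inserted is forced: between the excedances and the other elements of the block. *)
theory Submission
  imports Defs
begin

section \<open>The statistics in terms of elements\<close>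

lemma bij_betw_elem_at:
  assumes "finite J"
  shows "bij_betw (elem_at J) {1..card J} J"
proof -
  have "bij_betw (\<lambda>i. i - 1) {1..card J} {..<card J}"
    by (rule bij_betwI[where g = Suc]) auto
  moreover have "bij_betw ((!) (sorted_list_of_set J)) {..<card J} J"
    by (rule bij_betw_nth) (use assms in auto)
  ultimately have "bij_betw ((!) (sorted_list_of_set J) \<circ> (\<lambda>i. i - 1)) {1..card J} J"
    by (rule bij_betw_trans)
  then show ?thesis
    by (simp add: elem_at_def o_def cong: bij_betw_cong)
qed

text \<open>Since \<open>elem_at J\<close> enumerates \<open>J\<close> bijectively, counting indices
  amounts to counting elements; later arguments only use the latter.\<close>

lemma card_elem_at:
  assumes "finite J"
  shows "card {i. 1 \<le> i \<and> i \<le> card J \<and> P (elem_at J i)} = card {j \<in> J. P j}"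
proof (rule bij_betw_same_card)
  show "bij_betw (elem_at J) {i. 1 \<le> i \<and> i \<le> card J \<and> P (elem_at J i)} {j \<in> J. P j}"
    using bij_betw_elem_at[OF assms] unfolding bij_betw_def
    by (intro conjI) (force intro: inj_on_subset, force)
qed

lemma num_fix_eq: "finite J \<Longrightarrow> num_fix J \<sigma> = card {j \<in> J. \<sigma> j = j}"
  unfolding num_fix_def by (rule card_elem_at)

lemma exc_eq: "finite J \<Longrightarrow> exc J \<sigma> = card {j \<in> J. \<sigma> j > j}"
  unfolding exc_def by (rule card_elem_at)

lemma elem_at_atLeastAtMost: "1 \<le> i \<Longrightarrow> i \<le> n \<Longrightarrow> elem_at {1..n} i = i"
  unfolding elem_at_def atLeastLessThanSuc_atLeastAtMost[symmetric]
  by (simp del: upt_Suc)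

lemma DES_atLeastAtMost: "DES {1..n} \<sigma> = {i. 1 \<le> i \<and> i < n \<and> \<sigma> (Suc i) < \<sigma> i}"
proof -
  have "elem_at {1..n} i = i" "elem_at {1..n} (i + 1) = Suc i" if "1 \<le> i" "i < n" for i
    using that elem_at_atLeastAtMost[of _ n] by simp_all
  moreover have "i \<le> card {1..n} - 1 \<longleftrightarrow> i < n" if "1 \<le> i" for i
    using that by auto
  ultimately show ?thesis
    unfolding DES_def by fastforce
qed

text \<open>An increasing \<open>f\<close> that intertwines the two maps preserves the comparison of
  a point with its image, and points outside the range of \<open>f\<close> are fixed, hence no
  excedances.\<close>

lemma exc_image:
  assumes "finite A" "strict_mono_on A f" "\<tau> permutes A"
    and "f ` A \<subseteq> S" "finite S" and \<sigma>: "\<And>x. x \<in> A \<Longrightarrow> \<sigma> (f x) = f (\<tau> x)"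
    and fixed: "\<And>x. x \<in> S \<Longrightarrow> x \<notin> f ` A \<Longrightarrow> \<sigma> x = x"
  shows "exc S \<sigma> = exc A \<tau>"
proof -
  have less: "f x < f y \<longleftrightarrow> x < y" if "x \<in> A" "y \<in> A" for x y
    using strict_mono_on_less[OF assms(2)] that by blast
  have "{x \<in> S. x < \<sigma> x} = f ` {x \<in> A. x < \<tau> x}"
  proof (intro equalityI subsetI)
    fix y assume y: "y \<in> {x \<in> S. x < \<sigma> x}"
    then obtain x where "x \<in> A" "y = f x"
      using fixed[of y] by force
    with y show "y \<in> f ` {x \<in> A. x < \<tau> x}"
      using less[of x "\<tau> x"] \<sigma> permutes_in_image[OF assms(3)] by auto
  next
    fix y assume "y \<in> f ` {x \<in> A. x < \<tau> x}"
    then show "y \<in> {x \<in> S. x < \<sigma> x}"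
      using less \<sigma> permutes_in_image[OF assms(3)] assms(4) by auto
  qed
  moreover have "inj_on f {x \<in> A. x < \<tau> x}"
    using strict_mono_on_imp_inj_on[OF assms(2)] by (rule inj_on_subset) auto
  ultimately show ?thesis
    using assms(1,5) by (simp add: exc_eq card_image)
qed

section \<open>Fixed points and descents\<close>

lemma descents_imp_le:
  fixes \<sigma> :: "nat \<Rightarrow> 'a::order"
  assumes "\<And>i. i \<in> J \<Longrightarrow> \<sigma> (Suc i) < \<sigma> i" "{a..<b} \<subseteq> J" "a \<le> b"
  shows "\<sigma> b \<le> \<sigma> a"
  using assms(3,2)
proof (induction rule: dec_induct)
  case (step m)
  moreover from this have "{a..<m} \<subseteq> J" by auto
  ultimately have "\<sigma> (Suc m) < \<sigma> m" "\<sigma> m \<le> \<sigma> a" using assms(1)[of m] by auto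
  then show ?case by simp
qed simp

text \<open>A block is represented by its last position, so the elements of
  \<open>{1..n} - J\<close> index the blocks. The minimum exists for \<open>i \<le> n\<close>
  because \<open>n \<notin> J\<close>.\<close>

definition block_end :: "nat set \<Rightarrow> nat \<Rightarrow> nat" where
  "block_end J i = (LEAST e. i \<le> e \<and> e \<notin> J)"

section \<open>Blocks and the bound on the number of fixed points\<close>

context
  fixes n :: nat and J :: "nat set"
  assumes J: "J \<subseteq> {1..<n}"
begin

lemma block_end:
  assumes "i \<le> n"
  shows "i \<le> block_end J i" "block_end J i \<le> n" "block_end J i \<notin> J" "{i..<block_end J i} \<subseteq> J"
proof -
  have n: "i \<le> n \<and> n \<notin> J" using J assms by auto
  show "i \<le> block_end J i" "block_end J i \<notin> J"
    unfolding block_end_def using LeastI[of "\<lambda>e. i \<le> e \<and> e \<notin> J", OF n] by auto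
  show "block_end J i \<le> n"
    unfolding block_end_def by (rule Least_le) (rule n)
  show "{i..<block_end J i} \<subseteq> J"
    unfolding block_end_def using not_less_Least by fastforce
qed

lemma finite_descents: "finite J"
  using J finite_subset by blast

lemma card_non_descents: "card ({1..n} - J) = n - card J"
  using J by (subst card_Diff_subset[OF finite_descents]) auto

context
  fixes \<sigma> :: "nat \<Rightarrow> nat"
  assumes DES: "DES {1..n} \<sigma> = J"
begin

lemma run_le: "{a..<b} \<subseteq> J \<Longrightarrow> a \<le> b \<Longrightarrow> \<sigma> b \<le> \<sigma> a"
  by (rule descents_imp_le[of J \<sigma> a b]) (use DES in \<open>auto simp only: DES_atLeastAtMost\<close>)

text \<open>Fixed points \<open>i < k\<close> of one block would give
  \<open>k = \<sigma> k \<le> \<sigma> i = i\<close>.\<close>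

lemma inj_on_block_end_fixed: "inj_on (block_end J) {i \<in> {1..n}. \<sigma> i = i}"
proof (rule linorder_inj_onI)
  fix i k assume "i < k" and ik: "i \<in> {i \<in> {1..n}. \<sigma> i = i}" "k \<in> {i \<in> {1..n}. \<sigma> i = i}"
  show "block_end J i \<noteq> block_end J k"
  proof
    assume "block_end J i = block_end J k"
    then have "{i..<k} \<subseteq> J"
      using ik block_end(1)[of k] order_trans[OF _ block_end(4)[of i]] by simp
    with \<open>i < k\<close> ik run_le[of i k] show False by auto
  qed
qed auto

lemma block_end_fixed_subset: "block_end J ` {i \<in> {1..n}. \<sigma> i = i} \<subseteq> {1..n} - J"
  using block_end by fastforce

lemma num_fix_le: "num_fix {1..n} \<sigma> \<le> n - card J"
  using card_inj_on_le[OF inj_on_block_end_fixed block_end_fixed_subset]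
  by (simp add: num_fix_eq card_non_descents del: One_nat_def)

section \<open>The extremal case of the bound\<close>

context
  assumes max: "num_fix {1..n} \<sigma> = n - card J"
begin

text \<open>Equality of cardinalities makes the injection from fixed points to blocks surjective, so
  the block of \<open>i\<close> has a fixed point; the cases record on which side of
  \<open>i\<close> it lies.\<close>

lemma fixed_point_in_block:
  assumes "i \<in> {1..n}"
  obtains f where "\<sigma> f = f" "f \<le> i" "{f..<i} \<subseteq> J" | f where "\<sigma> f = f" "i \<le> f" "{i..<f} \<subseteq> J"
proof -
  have "block_end J ` {i \<in> {1..n}. \<sigma> i = i} = {1..n} - J"
    using max unfolding num_fix_eq[OF finite_atLeastAtMost]
    by (intro card_subset_eq[OF _ block_end_fixed_subset])
      (simp_all only: card_image[OF inj_on_block_end_fixed] card_non_descents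
        finite_Diff finite_atLeastAtMost)
  moreover have "block_end J i \<in> {1..n} - J"
    using assms block_end[of i] by auto
  ultimately have "block_end J i \<in> block_end J ` {i \<in> {1..n}. \<sigma> i = i}"
    by simp
  then obtain f where f: "block_end J i = block_end J f" "f \<in> {i \<in> {1..n}. \<sigma> i = i}"
    by (rule imageE)
  have n: "i \<le> n" "f \<le> n"
    using assms f(2) by simp_all
  have "{i..<f} \<subseteq> J"
    using f(1) block_end(1)[OF n(2)] by (intro order_trans[OF _ block_end(4)[OF n(1)]]) simp
  moreover have "{f..<i} \<subseteq> J"
    using f(1) block_end(1)[OF n(1)] by (intro order_trans[OF _ block_end(4)[OF n(2)]]) simp
  ultimately show ?thesis
    using f(2) that linear[of f i] by blast
qed

text \<open>A fixed point \<open>f \<le> i\<close> of the block would force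
  \<open>\<sigma> i \<le> f \<le> i\<close>, so \<open>f\<close> comes after \<open>i\<close>. The
  second claim forbids an excedance directly followed by a deficiency, which is what makes
  \<open>collapse \<sigma>\<close> increasing.\<close>

lemma excedance_in_J:
  assumes "i \<in> {1..n}" "\<sigma> i > i"
  shows "i \<in> J" "\<sigma> (Suc i) \<ge> Suc i"
proof -
  obtain f where f: "\<sigma> f = f" "i < f" "{i..<f} \<subseteq> J"
    using assms(1)
  proof (cases rule: fixed_point_in_block)
    case (1 f)
    then show ?thesis using run_le[of f i] assms by simp
  next
    case (2 f)
    then show ?thesis using assms that[of f] by (cases "i = f") auto
  qed
  then show "i \<in> J" by auto
  show "\<sigma> (Suc i) \<ge> Suc i" using run_le[of "Suc i" f] f by fastforce
qed

text \<open>Dually, the fixed point \<open>f\<close> of the block comes before \<open>i\<close>, and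
  the run from \<open>f\<close> to \<open>i\<close> passes through \<open>i - 1\<close>.\<close>

lemma deficiency_in_J:
  assumes "i \<in> {1..n}" "\<sigma> i < i"
  shows "i - 1 \<in> J"
  using assms(1)
proof (cases rule: fixed_point_in_block)
  case (1 f)
  then show ?thesis using assms by (cases "i = f") auto
next
  case (2 f)
  then show ?thesis using run_le[of i f] assms by simp
qed

end

end

end

section \<open>Deleting and inserting fixed points\<close>

text \<open>Only the values at moved points matter; there the second branch means
  \<open>\<sigma> i < i\<close>.\<close>

definition collapse :: "(nat \<Rightarrow> nat) \<Rightarrow> nat \<Rightarrow> nat" where
  "collapse \<sigma> i = (if \<sigma> i > i then i else i - 1)"

definition delete_fixed :: "(nat \<Rightarrow> nat) \<Rightarrow> nat \<Rightarrow> nat" where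
  "delete_fixed \<sigma> = map_permutation {i. \<sigma> i \<noteq> i} (collapse \<sigma>) \<sigma>"

text \<open>This inverts \<open>collapse\<close>: the increasing relabelling keeps excedances, so
  \<tau> alone reveals which branch was taken.\<close>

definition expand :: "(nat \<Rightarrow> nat) \<Rightarrow> nat \<Rightarrow> nat" where
  "expand \<tau> j = (if \<tau> j > j then j else Suc j)"

definition insert_fixed :: "nat set \<Rightarrow> (nat \<Rightarrow> nat) \<Rightarrow> nat \<Rightarrow> nat" where
  "insert_fixed J \<tau> = map_permutation J (expand \<tau>) \<tau>"

section \<open>From \<open>F_set n J\<close> to \<open>G_set J\<close>: deleting the fixed
  points\<close>

context
  fixes n :: nat and J :: "nat set" and \<sigma> :: "nat \<Rightarrow> nat" and A :: "nat set"
  assumes J: "J \<subseteq> {1..<n}" and \<sigma>: "\<sigma> \<in> F_set n J"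
  defines "A \<equiv> {i. \<sigma> i \<noteq> i}"
begin

lemma F_simps: "\<sigma> permutes {1..n}" "DES {1..n} \<sigma> = J" "num_fix {1..n} \<sigma> = n - card J"
  using \<sigma> by (auto simp: F_set_def)

lemma A_subset: "A \<subseteq> {1..n}"
  using F_simps(1) by (auto simp: A_def permutes_def)

lemma finite_A: "finite A"
  using A_subset finite_subset by blast

lemma permutes_A: "\<sigma> permutes A"
  by (rule permutes_superset[OF F_simps(1)]) (auto simp: A_def)

text \<open>Points move down by at most one, so the order can only fail for an excedance at
  \<open>i\<close> and a deficiency at \<open>Suc i\<close>.\<close>

lemma strict_mono_on_collapse: "strict_mono_on A (collapse \<sigma>)"
proof (rule strict_mono_onI)
  fix i k assume ik: "i \<in> A" "k \<in> A" "i < k"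
  show "collapse \<sigma> i < collapse \<sigma> k"
  proof (cases "\<sigma> i > i")
    case True
    then have "\<not> (k = Suc i \<and> \<sigma> k < k)"
      using excedance_in_J(2)[OF J F_simps(2,3), of i] A_subset ik by auto
    moreover have "\<sigma> k \<noteq> k"
      using ik by (simp add: A_def)
    ultimately show ?thesis using True ik by (cases "k = Suc i") (auto simp: collapse_def)
  next
    case False
    \<comment> \<open>\<open>A_subset\<close> gives \<open>i \<ge> 1\<close>, so
      \<open>i - 1 < i \<le> k - 1\<close> without truncation.\<close>
    with ik show ?thesis using A_subset by (fastforce simp: collapse_def A_def)
  qed
qed

lemma bij_betw_collapse: "bij_betw (collapse \<sigma>) A J"
proof -
  have inj: "inj_on (collapse \<sigma>) A"
    by (rule strict_mono_on_imp_inj_on[OF strict_mono_on_collapse])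
  have sub: "collapse \<sigma> ` A \<subseteq> J"
    using A_subset excedance_in_J(1)[OF J F_simps(2,3)] deficiency_in_J[OF J F_simps(2,3)]
    by (auto simp: collapse_def A_def)
  have "A = {1..n} - {i \<in> {1..n}. \<sigma> i = i}"
    using A_subset by (auto simp: A_def)
  then have "card A = n - num_fix {1..n} \<sigma>"
    using card_Diff_subset[of "{i \<in> {1..n}. \<sigma> i = i}" "{1..n}"]
    by (simp add: num_fix_eq subset_eq)
  \<comment> \<open>Needed to simplify the truncated difference \<open>n - (n - card J)\<close> to
    \<open>card J\<close>.\<close>
  moreover have "card J \<le> n"
    using card_mono[OF _ J] by simp
  ultimately have "card A = card J"
    using F_simps(3) by simp
  then show ?thesis
    using card_subset_eq[OF finite_descents[OF J] sub] inj
    by (simp add: bij_betw_def card_image)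
qed

lemma collapse_surj:
  assumes "j \<in> J"
  obtains i where "i \<in> A" "j = collapse \<sigma> i"
proof -
  have "j \<in> collapse \<sigma> ` A"
    using assms by (simp only: bij_betw_imp_surj_on[OF bij_betw_collapse])
  then show ?thesis
    by (elim imageE that)
qed

lemma delete_fixed_apply: "i \<in> A \<Longrightarrow> delete_fixed \<sigma> (collapse \<sigma> i) = collapse \<sigma> (\<sigma> i)"
  unfolding delete_fixed_def using bij_betw_collapse
  by (intro map_permutation_apply) (auto simp: A_def bij_betw_def)

lemma delete_fixed_permutes: "delete_fixed \<sigma> permutes J"
  unfolding delete_fixed_def
  using map_permutation_permutes[OF bij_betw_collapse permutes_A] by (simp add: A_def)

lemma collapse_less: "i \<in> A \<Longrightarrow> k \<in> A \<Longrightarrow> collapse \<sigma> i < collapse \<sigma> k \<longleftrightarrow> i < k"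
  using strict_mono_on_less[OF strict_mono_on_collapse] by blast

lemma permuted_in_A: "i \<in> A \<Longrightarrow> \<sigma> i \<in> A"
  using permutes_in_image[OF permutes_A] by blast

lemma delete_fixed_in_G: "delete_fixed \<sigma> \<in> G_set J"
proof -
  have "delete_fixed \<sigma> j \<noteq> j" if j: "j \<in> J" for j
  proof -
    obtain i where i: "i \<in> A" "j = collapse \<sigma> i"
      using j by (rule collapse_surj)
    then show ?thesis
      using inj_on_eq_iff[OF bij_betw_imp_inj_on[OF bij_betw_collapse]] permuted_in_A
      by (simp add: delete_fixed_apply) (simp add: A_def)
  qed
  moreover have "delete_fixed \<sigma> (j + 1) < delete_fixed \<sigma> j" if j: "j \<in> J" "j + 1 \<in> J" for j
  proof -
    obtain i where i: "i \<in> A" "j = collapse \<sigma> i"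
      using j(1) by (rule collapse_surj)
    obtain k where k: "k \<in> A" "j + 1 = collapse \<sigma> k"
      using j(2) by (rule collapse_surj)
    have "i < k"
      using collapse_less[of i k] i k by simp
    \<comment> \<open>\<open>i\<close> is \<open>j\<close> or \<open>j + 1\<close>, and
      \<open>k\<close> is \<open>j + 1\<close> or \<open>j + 2\<close>; hence all positions from
      \<open>i\<close> up to \<open>k - 1\<close> are descents of \<sigma>.\<close>
    have "{i..<k} \<subseteq> {j, j + 1}"
      using i k by (auto simp: collapse_def split: if_splits)
    then have "\<sigma> k \<le> \<sigma> i"
      using run_le[OF J F_simps(2), of i k] j \<open>i < k\<close> by auto
    moreover have "\<sigma> k \<noteq> \<sigma> i"
      using \<open>i < k\<close> permutes_inj[OF F_simps(1)] by (auto dest: injD)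
    ultimately have "collapse \<sigma> (\<sigma> k) < collapse \<sigma> (\<sigma> i)"
      using collapse_less permuted_in_A i(1) k(1) by simp
    then show ?thesis
      using delete_fixed_apply[OF i(1)] delete_fixed_apply[OF k(1)] i(2) k(2) by simp
  qed
  ultimately show ?thesis
    using delete_fixed_permutes by (auto simp: G_set_def derangement_on_def)
qed

lemma insert_delete_fixed: "insert_fixed J (delete_fixed \<sigma>) = \<sigma>"
proof -
  have "expand (delete_fixed \<sigma>) (collapse \<sigma> i) = i" if "i \<in> A" for i
  proof -
    have "collapse \<sigma> i < collapse \<sigma> (\<sigma> i) \<longleftrightarrow> i < \<sigma> i"
      using collapse_less that permuted_in_A by blast
    then show ?thesis
      using that A_subset by (auto simp: expand_def delete_fixed_apply) (auto simp: collapse_def)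
  qed
  then show ?thesis
    unfolding insert_fixed_def
    using map_permutation_compose_inv[OF bij_betw_collapse permutes_A]
    by (simp add: delete_fixed_def A_def)
qed

lemma exc_delete_fixed: "exc J (delete_fixed \<sigma>) = exc {1..n} \<sigma>"
proof -
  have "exc J (delete_fixed \<sigma>) = exc A \<sigma>"
    using bij_betw_collapse
    by (intro exc_image[OF finite_A strict_mono_on_collapse permutes_A])
      (auto simp: delete_fixed_apply bij_betw_def finite_descents[OF J])
  also have "\<dots> = exc {1..n} \<sigma>"
    using A_subset finite_A by (auto simp: exc_eq A_def intro!: arg_cong[of _ _ card])
  finally show ?thesis .
qed

end

section \<open>From \<open>G_set J\<close> to \<open>F_set n J\<close>: inserting the fixed
  points\<close>

context
  fixes n :: nat and J :: "nat set" and \<tau> :: "nat \<Rightarrow> nat"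
  assumes J: "J \<subseteq> {1..<n}" and \<tau>: "\<tau> \<in> G_set J"
begin

lemma G_simps:
  "\<tau> permutes J" "j \<in> J \<Longrightarrow> \<tau> j \<noteq> j" "j \<in> J \<Longrightarrow> Suc j \<in> J \<Longrightarrow> \<tau> (Suc j) < \<tau> j"
  using \<tau> by (auto simp: G_set_def derangement_on_def)

lemma permuted_in_J: "j \<in> J \<Longrightarrow> \<tau> j \<in> J"
  using permutes_in_image[OF G_simps(1)] by blast

text \<open>Points move up by at most one, so a collision needs \<open>\<tau> i \<le> i\<close> and
  \<open>\<tau> (Suc i) > Suc i\<close>, contradicting the descent at \<open>i\<close>.\<close>

lemma strict_mono_on_expand: "strict_mono_on J (expand \<tau>)"
proof (rule strict_mono_onI)
  fix i k assume ik: "i \<in> J" "k \<in> J" "i < k"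
  then have "\<not> (k = Suc i \<and> \<tau> i \<le> i \<and> \<tau> k > k)"
    using G_simps(3)[of i] by auto
  with ik show "expand \<tau> i < expand \<tau> k" by (cases "k = Suc i") (auto simp: expand_def)
qed

lemma expand_less: "i \<in> J \<Longrightarrow> k \<in> J \<Longrightarrow> expand \<tau> i < expand \<tau> k \<longleftrightarrow> i < k"
  using strict_mono_on_less[OF strict_mono_on_expand] by blast

lemma bij_betw_expand: "bij_betw (expand \<tau>) J (expand \<tau> ` J)"
  using strict_mono_on_imp_inj_on[OF strict_mono_on_expand] by (simp add: bij_betw_def)

lemma expand_image_subset: "expand \<tau> ` J \<subseteq> {1..n}"
  using J by (auto simp: expand_def)

lemma insert_fixed_apply: "j \<in> J \<Longrightarrow> insert_fixed J \<tau> (expand \<tau> j) = expand \<tau> (\<tau> j)"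
  unfolding insert_fixed_def using bij_betw_expand
  by (intro map_permutation_apply) (auto simp: bij_betw_def)

lemma insert_fixed_permutes_image: "insert_fixed J \<tau> permutes expand \<tau> ` J"
  unfolding insert_fixed_def using map_permutation_permutes[OF bij_betw_expand G_simps(1)] .

lemma insert_fixed_outside: "i \<notin> expand \<tau> ` J \<Longrightarrow> insert_fixed J \<tau> i = i"
  using permutes_not_in[OF insert_fixed_permutes_image] .

lemma insert_fixed_moves: "{i. insert_fixed J \<tau> i \<noteq> i} = expand \<tau> ` J"
proof -
  have "insert_fixed J \<tau> (expand \<tau> j) \<noteq> expand \<tau> j" if "j \<in> J" for j
    using that G_simps(2) permuted_in_J inj_on_eq_iff[OF bij_betw_imp_inj_on[OF bij_betw_expand]]
    by (simp add: insert_fixed_apply)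
  then show ?thesis using insert_fixed_outside by blast
qed

lemma insert_fixed_excedance:
  "j \<in> J \<Longrightarrow> \<tau> j > j \<Longrightarrow> insert_fixed J \<tau> j = expand \<tau> (\<tau> j)"
  using insert_fixed_apply[of j] by (simp add: expand_def)

lemma insert_fixed_deficiency:
  "j \<in> J \<Longrightarrow> \<tau> j \<le> j \<Longrightarrow> insert_fixed J \<tau> (Suc j) = expand \<tau> (\<tau> j)"
  using insert_fixed_apply[of j] by (simp add: expand_def)

text \<open>Position \<open>Suc i\<close> can only be taken by a deficiency \<open>i\<close> of
  \<tau>, which the hypothesis excludes, or by an excedance \<open>Suc i\<close>; otherwise it is
  fixed. With \<open>insert_fixed_le\<close>, this yields the ascents at positions outside
  \<open>J\<close>.\<close>

lemma insert_fixed_Suc_ge: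
  assumes "i \<in> J \<Longrightarrow> \<tau> i > i"
  shows "insert_fixed J \<tau> (Suc i) \<ge> Suc i"
proof (cases "Suc i \<in> expand \<tau> ` J")
  case True
  then have "Suc i \<in> J" "\<tau> (Suc i) > Suc i"
    using assms by (auto simp: expand_def split: if_splits)
  then show ?thesis
    by (auto simp: insert_fixed_excedance expand_def)
qed (simp add: insert_fixed_outside)

lemma insert_fixed_le:
  assumes "i \<in> J \<Longrightarrow> \<tau> i \<le> i"
  shows "insert_fixed J \<tau> i \<le> i"
proof (cases "i \<in> expand \<tau> ` J")
  case True
  then obtain j where "j \<in> J" "\<tau> j \<le> j" "i = Suc j"
    using assms by (auto simp: expand_def split: if_splits)
  then show ?thesis
    using G_simps(2)[of j] by (auto simp: insert_fixed_deficiency expand_def)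
qed (simp add: insert_fixed_outside)

text \<open>The element \<open>i\<close> occupies position \<open>i\<close> if it is an excedance of
  \<tau> and position \<open>Suc i\<close> otherwise. The other position holds a neighbour of
  \<open>i\<close>, and the descent of \<tau> decides, or it is an inserted fixed point.\<close>

lemma insert_fixed_descent:
  assumes i: "i \<in> J"
  shows "insert_fixed J \<tau> (Suc i) < insert_fixed J \<tau> i"
proof (cases "\<tau> i > i")
  case True
  show ?thesis
  proof (cases "Suc i \<in> J \<and> \<tau> (Suc i) > Suc i")
    case exc: True
    then show ?thesis
      using True i G_simps(3)[of i] expand_less[of "\<tau> (Suc i)" "\<tau> i"] permuted_in_J
      by (simp add: insert_fixed_excedance)
  next
    case False
    then have "Suc i \<notin> expand \<tau> ` J"
      using True by (auto simp: expand_def split: if_splits)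
    moreover have "expand \<tau> (\<tau> i) > Suc i"
    \<comment> \<open>If \<open>\<tau> i = Suc i\<close>, then \<open>Suc i\<close> lies in
      \<open>J\<close> but is no excedance, so \<open>expand\<close> raises it to
      \<open>i + 2\<close>.\<close>
    proof (cases "\<tau> i = Suc i")
      case True
      then show ?thesis
        using False permuted_in_J[OF i] by (auto simp: expand_def)
    next
      case False
      with \<open>\<tau> i > i\<close> show ?thesis by (auto simp: expand_def)
    qed
    ultimately show ?thesis
      using True i by (simp add: insert_fixed_outside insert_fixed_excedance)
  qed
next
  case False
  then have less: "\<tau> i < i" using G_simps(2)[OF i] by simp
  show ?thesis
  proof (cases "i \<in> expand \<tau> ` J")
    case True
    then obtain j where j: "j \<in> J" "\<tau> j \<le> j" "i = Suc j"
      using False by (auto simp: expand_def split: if_splits)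
    then have "expand \<tau> (\<tau> i) < expand \<tau> (\<tau> j)"
      using i G_simps(3)[of j] expand_less permuted_in_J by simp
    then show ?thesis
      using i j less insert_fixed_deficiency[of i] insert_fixed_deficiency[of j] by simp
  next
    case out: False
    \<comment> \<open>The value lies in the range of \<open>expand \<tau>\<close> on
      \<open>J\<close>, unlike \<open>i\<close>; as it is at most
      \<open>Suc (\<tau> i) \<le> i\<close>, it is smaller than \<open>i\<close>.\<close>
    then have "expand \<tau> (\<tau> i) \<noteq> i"
      using imageI[OF permuted_in_J[OF i], of "expand \<tau>"] by auto
    then have "expand \<tau> (\<tau> i) < i"
      using less by (auto simp: expand_def split: if_splits)
    then show ?thesis
      using i out less insert_fixed_deficiency[of i] by (simp add: insert_fixed_outside)
  qed
qed

lemma insert_fixed_in_F: "insert_fixed J \<tau> \<in> F_set n J"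
proof -
  \<comment> \<open>For \<open>i \<notin> J\<close> the premises of both bounds hold vacuously, and
    \<open>i\<close> and \<open>Suc i\<close> separate the two values.\<close>
  have "insert_fixed J \<tau> i \<le> insert_fixed J \<tau> (Suc i)" if "i \<notin> J" for i
    using insert_fixed_le[of i] insert_fixed_Suc_ge[of i] that by simp
  then have "insert_fixed J \<tau> (Suc i) < insert_fixed J \<tau> i \<longleftrightarrow> i \<in> J" for i
    using insert_fixed_descent[of i] by (meson not_less)
  then have "DES {1..n} (insert_fixed J \<tau>) = J"
    using J unfolding DES_atLeastAtMost by auto
  moreover have "{i \<in> {1..n}. insert_fixed J \<tau> i = i} = {1..n} - expand \<tau> ` J"
    using insert_fixed_moves by blast
  then have "num_fix {1..n} (insert_fixed J \<tau>) = n - card J"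
    using expand_image_subset finite_descents[OF J] bij_betw_same_card[OF bij_betw_expand]
    by (simp add: num_fix_eq card_Diff_subset)
  moreover have "insert_fixed J \<tau> permutes {1..n}"
    by (rule permutes_subset[OF insert_fixed_permutes_image expand_image_subset])
  ultimately show ?thesis by (simp add: F_set_def)
qed

text \<open>The moved points are exactly the expanded ones, and \<open>expand \<tau>\<close>
  preserves excedances, so \<open>collapse\<close> undoes the same branch.\<close>

lemma delete_insert_fixed: "delete_fixed (insert_fixed J \<tau>) = \<tau>"
proof -
  have "collapse (insert_fixed J \<tau>) (expand \<tau> j) = j" if "j \<in> J" for j
  proof -
    have "expand \<tau> j < expand \<tau> (\<tau> j) \<longleftrightarrow> j < \<tau> j"
      using expand_less that permuted_in_J by blast
    then show ?thesis
      using that by (auto simp: collapse_def insert_fixed_apply) (auto simp: expand_def)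
  qed
  then show ?thesis
    unfolding delete_fixed_def insert_fixed_moves
    using map_permutation_compose_inv[OF bij_betw_expand G_simps(1)]
    by (simp add: insert_fixed_def)
qed

end

theorem theorem1:
  fixes n :: nat and J :: "nat set"
  assumes "n \<ge> 1" and "J \<subseteq> {1..n - 1}"
  shows "(\<forall>\<sigma>. \<sigma> permutes {1..n} \<and> DES {1..n} \<sigma> = J \<longrightarrow> num_fix {1..n} \<sigma> \<le> n - card J) \<and>
    (\<Sum>\<sigma>\<in>F_set n J. monom (1::int) (exc {1..n} \<sigma>)) = (\<Sum>\<tau>\<in>G_set J. monom (1::int) (exc J \<tau>))"
proof -
  have J: "J \<subseteq> {1..<n}"
    using assms by fastforce
  have "(\<Sum>\<sigma>\<in>F_set n J. monom (1::int) (exc {1..n} \<sigma>)) = (\<Sum>\<tau>\<in>G_set J. monom (1::int) (exc J \<tau>))"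
    by (rule sum.reindex_bij_witness[of _ "insert_fixed J" delete_fixed])
      (simp_all only: insert_delete_fixed[OF J] delete_insert_fixed[OF J] delete_fixed_in_G[OF J]
        insert_fixed_in_F[OF J] exc_delete_fixed[OF J])
  then show ?thesis
    using num_fix_le[OF J] by blast
qed

end
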